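(* There exists a bijective Costas cloud on $\mathbb{R}\times(0,\infty)$, i.e. a bijection $g:\mathbb{R}\to(0,\infty)$ that is discontinuous at every point of $\mathbb{R}$, whose graph is dense in $\mathbb{R}\times(0,\infty)$, and such that for all $x,y\in\mathbb{R}$ and all $t\in\mathbb{R}\setminus\{0\}$, $g(x+t)-g(x)=g(y+t)-g(y)$ implies $x=y$.
   Context: For intervals $A,B\subseteq\mathbb{R}$, a Costas cloud on $A\times B$ is an injection $f:A\to B$ which is discontinuous at every point of $A$, whose graph $\{(x,f(x)):x\in A\}$ is dense in $A\times B$, and which has the Costas property with respect to $T=\{t\in\mathbb{R}\setminus\{0\}:(t+A)\cap A\neq\emptyset\}$: for all $a_1,a_2\in A$ and $t\in T$ with $t+a_1,t+a_2\in A$, $f(t+a_1)+f(a_2)=f(t+a_2)+f(a_1)$ implies $a_1=a_2$. It is a bijective Costas cloud if moreover $f$ is a bijection onto $B$. *)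

theory Defs
  imports "HOL-Analysis.Analysis"
begin

definition shift_set :: "real set \<Rightarrow> real set" where
  "shift_set A = {t. t \<noteq> 0 \<and> ((\<lambda>a. t + a) ` A) \<inter> A \<noteq> {}}"

definition costas_property :: "real set \<Rightarrow> real set \<Rightarrow> (real \<Rightarrow> real) \<Rightarrow> bool" where
  "costas_property T A f \<longleftrightarrow>
     (\<forall>a1\<in>A. \<forall>a2\<in>A. \<forall>t\<in>T. t + a1 \<in> A \<longrightarrow> t + a2 \<in> A \<longrightarrow>
        f (t + a1) + f a2 = f (t + a2) + f a1 \<longrightarrow> a1 = a2)"

text \<open>A function \<open>A \<rightarrow> B\<close> is represented by a total function on the reals of which only the
  values on \<open>A\<close> matter; in particular continuity is taken relative to \<open>A\<close>.\<close>

definition costas_cloud :: "real set \<Rightarrow> real set \<Rightarrow> (real \<Rightarrow> real) \<Rightarrow> bool" where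
  "costas_cloud A B f \<longleftrightarrow>
     is_interval A \<and> is_interval B \<and>
     f ` A \<subseteq> B \<and> inj_on f A \<and>
     (\<forall>x\<in>A. \<not> continuous (at x within A) f) \<and>
     A \<times> B \<subseteq> closure ((\<lambda>x. (x, f x)) ` A) \<and>
     costas_property (shift_set A) A f"

definition bijective_costas_cloud :: "real set \<Rightarrow> real set \<Rightarrow> (real \<Rightarrow> real) \<Rightarrow> bool" where
  "bijective_costas_cloud A B f \<longleftrightarrow> costas_cloud A B f \<and> bij_betw f A B"

lemma shift_set_UNIV: "shift_set UNIV = UNIV - {0}"
  unfolding shift_set_def by auto

lemma bijective_costas_cloud_UNIV_pos_iff:
  "bijective_costas_cloud UNIV {0<..} g \<longleftrightarrow>
     bij_betw g UNIV {0<..} \<and>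
     (\<forall>x. \<not> isCont g x) \<and>
     UNIV \<times> {0<..} \<subseteq> closure (range (\<lambda>x. (x, g x))) \<and>
     (\<forall>x y t. t \<noteq> 0 \<longrightarrow> g (x + t) - g x = g (y + t) - g y \<longrightarrow> x = y)"
proof -
  have "g (t + x) + g y = g (t + y) + g x \<longleftrightarrow> g (x + t) - g x = g (y + t) - g y" for x y t
    by (simp add: add.commute[of t]) linarith
  then have "costas_property (shift_set UNIV) UNIV g \<longleftrightarrow>
      (\<forall>x y t. t \<noteq> 0 \<longrightarrow> g (x + t) - g x = g (y + t) - g y \<longrightarrow> x = y)"
    unfolding costas_property_def shift_set_UNIV by simp blast
  moreover have "is_interval {(0::real)<..}"
    by (simp add: is_interval_1)
  ultimately show ?thesis
    unfolding bijective_costas_cloud_def costas_cloud_def bij_betw_def by simp blast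
qed

end

theory Submission
  imports Defs "HOL-Combinatorics.Transposition"
begin

text \<open>
  If \<open>\<phi>\<close> is an additive bijection of the reals and \<open>g = exp \<circ> \<phi>\<close>, then
  \<open>g (x + t) - g x = g x * (g t - 1)\<close> with \<open>g t \<noteq> 1\<close> for \<open>t \<noteq> 0\<close>, so this difference
  determines \<open>x\<close>.  For \<open>\<phi>\<close> take the rational-linear involution that exchanges \<open>1\<close> and
  \<open>sqrt 2\<close> in a Hamel basis containing both. Its graph contains the rational span of
  \<open>(1, sqrt 2)\<close> and \<open>(sqrt 2, 1)\<close>, which is dense in the plane.
\<close>

text \<open>Taking the rationals as scalars makes a basis of the reals a Hamel basis.\<close>

interpretation rat_real: vector_space "\<lambda>(q::rat) (x::real). of_rat q * x"
  by unfold_locales (simp_all add: algebra_simps of_rat_add of_rat_mult)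

interpretation rat_real_pair: vector_space_pair
  "\<lambda>(q::rat) (x::real). of_rat q * x" "\<lambda>(q::rat) (x::real). of_rat q * x"
  by unfold_locales

abbreviation rat_linear :: "(real \<Rightarrow> real) \<Rightarrow> bool" where
  "rat_linear \<equiv>
    Vector_Spaces.linear (\<lambda>(q::rat) x. of_rat q * x) (\<lambda>(q::rat) x. of_rat q * x)"

lemma sqrt_2_irrational: "sqrt 2 \<notin> \<rat>"
proof
  assume "sqrt 2 \<in> \<rat>"
  then obtain m n :: nat where "n \<noteq> 0" and mn: "sqrt 2 = m / n" and "coprime m n"
    by (auto elim!: Rats_abs_nat_div_natE)
  then have "sqrt 2 * n = m" by simp
  then have "(sqrt 2 * n)\<^sup>2 = (real m)\<^sup>2" by simp
  then have "real (2 * n\<^sup>2) = real (m\<^sup>2)" by (simp add: power_mult_distrib)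
  then have eq: "2 * n\<^sup>2 = m\<^sup>2" by (simp only: of_nat_eq_iff)
  then have "even m" by (metis dvd_triv_left even_power)
  then obtain k where "m = 2 * k" by blast
  with eq have "n\<^sup>2 = 2 * k\<^sup>2" by (simp add: power_mult_distrib)
  then have "even n" by (metis dvd_triv_left even_power)
  with \<open>even m\<close> \<open>coprime m n\<close> show False
    using coprime_common_divisor_nat[of m n 2] by simp
qed

text \<open>The rational span of \<open>1\<close> is the set of rationals, so independence amounts
  to the irrationality of \<open>sqrt 2\<close>. It allows both numbers to sit in one Hamel
  basis.\<close>

lemma independent_1_sqrt_2: "rat_real.independent {1, sqrt 2}"
proof -
  have "sqrt 2 \<notin> rat_real.span {1}"
    using sqrt_2_irrational by (auto simp: rat_real.span_singleton)
  then have "rat_real.independent {sqrt 2, 1}"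
    by (subst rat_real.independent_insert) (auto simp: rat_real.dependent_single)
  then show ?thesis by (simp add: insert_commute)
qed

lemma rat_linear_involution_swapping_1_sqrt_2:
  obtains \<phi> where
    "rat_linear \<phi>"
    "\<And>x. \<phi> (\<phi> x) = x" "\<phi> 1 = sqrt 2" "\<phi> (sqrt 2) = 1"
proof -
  define B where "B = rat_real.extend_basis {1, sqrt 2}"
  have B: "rat_real.independent B" "rat_real.span B = UNIV" "1 \<in> B" "sqrt 2 \<in> B"
    using rat_real.independent_extend_basis[OF independent_1_sqrt_2]
      rat_real.span_extend_basis[OF independent_1_sqrt_2]
      rat_real.extend_basis_superset[OF independent_1_sqrt_2]
    by (auto simp: B_def)
  obtain \<phi> where
    lin: "rat_linear \<phi>"
    and on_B: "\<And>x. x \<in> B \<Longrightarrow> \<phi> x = Transposition.transpose 1 (sqrt 2) x"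
    using rat_real_pair.linear_independent_extend[OF B(1)] by blast
  have "\<phi> (\<phi> x) = x" for x
  proof -
    have "(\<phi> \<circ> \<phi>) x = id x"
    proof (rule rat_real_pair.linear_eq_on_span[where f = "\<phi> \<circ> \<phi>" and g = id])
      show "rat_linear (\<phi> \<circ> \<phi>)"
        using lin lin by (rule Vector_Spaces.linear_compose)
      show "rat_linear id"
        by (rule rat_real.linear_id)
      show "(\<phi> \<circ> \<phi>) b = id b" if "b \<in> B" for b
        \<comment> \<open>The transposition maps \<open>B\<close> into itself because
          \<open>1\<close> and \<open>sqrt 2\<close> both lie in \<open>B\<close>; hence
          \<open>on_B\<close> applies a second time, to \<open>\<phi> b\<close>.\<close>
        using that B by (auto simp: on_B Transposition.transpose_def)
    qed (simp add: B(2))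
    then show ?thesis by simp
  qed
  moreover have "\<phi> 1 = sqrt 2" "\<phi> (sqrt 2) = 1"
    using B by (auto simp: on_B)
  ultimately show ?thesis using lin that by blast
qed

text \<open>Density yields points of the graph that approach \<open>x\<close> horizontally while
  their heights tend to a value other than \<open>g x\<close>.\<close>

lemma dense_graph_imp_not_isCont:
  fixes g :: "real \<Rightarrow> real"
  assumes "UNIV \<times> {0<..} \<subseteq> closure (range (\<lambda>x. (x, g x)))"
  shows "\<not> isCont g x"
proof
  assume cont: "isCont g x"
  \<comment> \<open>The height must be positive, to lie where density is assumed, and different from
    \<open>g x\<close>; this choice is both, whatever the sign of \<open>g x\<close>.\<close>
  define c where "c = \<bar>g x\<bar> + 1"
  have "(x, c) \<in> closure (range (\<lambda>x. (x, g x)))"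
    using assms by (auto simp: c_def)
  then obtain s where s: "\<And>n. s n \<in> range (\<lambda>x. (x, g x))" "s \<longlonglongrightarrow> (x, c)"
    by (auto simp: closure_sequential)
  have "(\<lambda>n. fst (s n)) \<longlonglongrightarrow> x" "(\<lambda>n. snd (s n)) \<longlonglongrightarrow> c"
    using tendsto_fst[OF s(2)] tendsto_snd[OF s(2)] by auto
  moreover have "snd (s n) = g (fst (s n))" for n
    using s(1)[of n] by auto
  ultimately have "c = g x"
    using isCont_tendsto_compose[OF cont, of "\<lambda>n. fst (s n)" sequentially]
    by (simp add: LIMSEQ_unique)
  then show False by (auto simp: c_def)
qed

text \<open>The continuous map \<open>F\<close> below sends rational pairs into the graph, hence the
  whole plane into its closure, and \<open>F\<close> reaches every point of the open upper
  half-plane.\<close>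

lemma closure_graph_exp_superset:
  fixes \<phi> :: "real \<Rightarrow> real"
  assumes \<phi>: "\<And>a b. a \<in> \<rat> \<Longrightarrow> b \<in> \<rat> \<Longrightarrow> \<phi> (a + b * sqrt 2) = a * sqrt 2 + b"
  shows "UNIV \<times> {0<..} \<subseteq> closure (range (\<lambda>x. (x, exp (\<phi> x))))"
proof -
  define F :: "real \<times> real \<Rightarrow> real \<times> real"
    where "F = (\<lambda>(a, b). (a + b * sqrt 2, exp (a * sqrt 2 + b)))"
  have "F ` closure (\<rat> \<times> \<rat>) \<subseteq> closure (range (\<lambda>x. (x, exp (\<phi> x))))"
  proof (rule image_closure_subset)
    show "continuous_on (closure (\<rat> \<times> \<rat>)) F"
      unfolding F_def case_prod_beta by (intro continuous_intros)
    show "F ` (\<rat> \<times> \<rat>) \<subseteq> closure (range (\<lambda>x. (x, exp (\<phi> x))))"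
    proof -
      have "F (a, b) \<in> range (\<lambda>x. (x, exp (\<phi> x)))" if "a \<in> \<rat>" "b \<in> \<rat>" for a b
        using that by (auto simp: F_def \<phi>)
      then show ?thesis using closure_subset by blast
    qed
  qed simp
  moreover have "closure (\<rat> \<times> \<rat> :: (real \<times> real) set) = UNIV"
    by (simp add: closure_Times Rats_closure_real)
  moreover have "(x, y) \<in> range F" if "y > 0" for x y
  proof
    \<comment> \<open>The arguments solve the linear system \<open>a + b * sqrt 2 = x\<close>,
      \<open>a * sqrt 2 + b = ln y\<close>, whose determinant is \<open>-1\<close>.\<close>
    show "(x, y) = F (ln y * sqrt 2 - x, x * sqrt 2 - ln y)"
      using that by (simp add: F_def algebra_simps)
  qed simp
  ultimately show ?thesis by auto
qed

lemma exp_additive_diff_inject: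
  fixes \<phi> :: "real \<Rightarrow> real"
  assumes add: "\<And>x y. \<phi> (x + y) = \<phi> x + \<phi> y" and "inj \<phi>" "t \<noteq> 0"
    and eq: "exp (\<phi> (x + t)) - exp (\<phi> x) = exp (\<phi> (y + t)) - exp (\<phi> y)"
  shows "x = y"
proof -
  have "\<phi> 0 = 0" using add[of 0 0] by simp
  \<comment> \<open>Otherwise \<open>\<phi> t = 0 = \<phi> 0\<close>, and injectivity would give
    \<open>t = 0\<close>.\<close>
  then have "exp (\<phi> t) \<noteq> 1"
    using \<open>inj \<phi>\<close> \<open>t \<noteq> 0\<close> by (metis exp_eq_one_iff injD)
  moreover have "exp (\<phi> x) * (exp (\<phi> t) - 1) = exp (\<phi> y) * (exp (\<phi> t) - 1)"
    using eq by (simp add: add exp_add algebra_simps)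
  ultimately have "\<phi> x = \<phi> y" by simp
  then show ?thesis using \<open>inj \<phi>\<close> by (simp add: inj_eq)
qed

theorem theorem11:
  shows "\<exists>g :: real \<Rightarrow> real. bijective_costas_cloud UNIV {0<..} g"
proof -
  obtain \<phi> where
    lin: "rat_linear \<phi>"
    and inv: "\<And>x. \<phi> (\<phi> x) = x" and swap: "\<phi> 1 = sqrt 2" "\<phi> (sqrt 2) = 1"
    using rat_linear_involution_swapping_1_sqrt_2 by blast
  have add: "\<phi> (x + y) = \<phi> x + \<phi> y" for x y
    using lin by (rule rat_real_pair.linear_add)
  have scale: "\<phi> (of_rat q * x) = of_rat q * \<phi> x" for q x
    using lin by (rule rat_real_pair.linear_scale)
  have bij: "bij \<phi>" using inv by (rule involuntory_imp_bij)
  have "bij_betw exp UNIV {0 :: real<..}"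
    by (rule bij_betw_byWitness[where f' = ln]) auto
  then have "bij_betw (\<lambda>x. exp (\<phi> x)) UNIV {0<..}"
    using bij_betw_trans[OF bij] by (simp add: comp_def)
  moreover have dense: "UNIV \<times> {0<..} \<subseteq> closure (range (\<lambda>x. (x, exp (\<phi> x))))"
  proof (rule closure_graph_exp_superset)
    fix a b :: real assume "a \<in> \<rat>" "b \<in> \<rat>"
    then obtain p q where "a = of_rat p" "b = of_rat q" by (auto elim!: Rats_cases)
    then show "\<phi> (a + b * sqrt 2) = a * sqrt 2 + b"
      \<comment> \<open>Rational coefficients pass through \<open>\<phi>\<close>, which only
        exchanges \<open>1\<close> and \<open>sqrt 2\<close>.\<close>
      using scale[of p 1] scale[of q "sqrt 2"] by (simp add: add swap)
  qed
  ultimately have "bijective_costas_cloud UNIV {0<..} (\<lambda>x. exp (\<phi> x))"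
    unfolding bijective_costas_cloud_UNIV_pos_iff
    using dense_graph_imp_not_isCont[OF dense] exp_additive_diff_inject[OF add bij_is_inj[OF bij]]
    by blast
  then show ?thesis by blast
qed

end
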